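(* Let $X$ be a finite subset of a metric space $(M,d)$. For $A\subseteq X$ let $\ell(A)$ be the minimum length of a metric Steiner tree connecting the points of $A$ in $(M,d)$, let $k\ge 2$, and let $\delta^{(k)}(A)=\max\{\ell(B):|B|\le k,\ B\subseteq A\}$ for $A\subseteq X$. If $(T,w)$ is a minimum length solution for the diversity Steiner problem applied to $(X,\delta^{(k)})$, then the length $\sum_{e\in E(T)}w(e)$ of $T$ is a lower bound for $\ell(X)$, the optimal length of a metric Steiner tree for $X$; that is, $\sum_{e\in E(T)}w(e)\le\ell(X)$.
   Context: A diversity is a pair $(X,\delta)$ where $X$ is a set and $\delta$ is a real-valued function on the finite subsets of $X$ satisfying, for all finite $A,B,C\subseteq X$: (D1) $\delta(A)\ge 0$, and $\delta(A)=0$ if and only if $|A|\le 1$; (D2) if $B\ne\emptyset$ then $\delta(A\cup C)\le\delta(A\cup B)+\delta(B\cup C)$. Metric Steiner problem: given a finite subset $A$ of a metric space $(M,d)$, find a (graph-theoretic, finite) tree $T$ with $A\subseteq V(T)\subseteq M$ for which the length $\sum_{\{u,v\}\in E(T)}d(u,v)$ is minimised. $\ell(A)$ denotes this minimum length (it is presupposed that the minimum exists for each $A\subseteq X$); $\ell(\emptyset)=0$. Both $(X,\ell)$ and $(X,\delta^{(k)})$ are diversities. For a (finite) tree $T$ with edge weights $w:E(T)\to\mathbb{R}_{\ge 0}$ and $A\subseteq V(T)$, $\delta_w(A)$ denotes the sum of the edge weights in the smallest subtree of $T$ connecting $A$. Diversity Steiner problem: given a finite diversity $(X,\delta)$, find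 a (graph-theoretic, finite) tree $T$ and edge weighting $w:E(T)\to\mathbb{R}_{\ge 0}$ such that $X\subseteq V(T)$, $\delta_w(Y)\ge\delta(Y)$ for all $Y\subseteq X$, and $\sum_{e\in E(T)}w(e)$ is minimised. *)

theory Defs
  imports "HOL-Analysis.Abstract_Metric_Spaces"
begin

section \<open>Finite trees\<close>

text \<open>
  A simple undirected graph is a pair of a vertex set and a set of edges, an edge being a
  two-element set of vertices.
\<close>

type_synonym 'v ugraph = "'v set \<times> 'v set set"

abbreviation verts :: "'v ugraph \<Rightarrow> 'v set" where "verts \<equiv> fst"
abbreviation edges :: "'v ugraph \<Rightarrow> 'v set set" where "edges \<equiv> snd"

definition is_cycle :: "'v ugraph \<Rightarrow> 'v list \<Rightarrow> bool" where
  "is_cycle G p \<longleftrightarrow> length p \<ge> 3 \<and> distinct p \<and>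
     (\<forall>i<length p. {p ! i, p ! (Suc i mod length p)} \<in> edges G)"

definition is_tree :: "'v ugraph \<Rightarrow> bool" where
  "is_tree T \<longleftrightarrow>
     finite (verts T) \<and> verts T \<noteq> {} \<and>
     (\<forall>e \<in> edges T. e \<subseteq> verts T \<and> card e = 2) \<and>
     (\<forall>u \<in> verts T. \<forall>v \<in> verts T. (u, v) \<in> {(x, y). {x, y} \<in> edges T}\<^sup>*) \<and>
     (\<nexists>p. is_cycle T p)"

definition is_subtree :: "'v ugraph \<Rightarrow> 'v ugraph \<Rightarrow> bool" where
  "is_subtree S T \<longleftrightarrow> is_tree S \<and> verts S \<subseteq> verts T \<and> edges S \<subseteq> edges T"

section \<open>The metric Steiner problem\<close>

text \<open>The description operator is well defined on edges \<open>{u, v}\<close> as soon as \<open>d\<close> is symmetric.\<close>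

definition metric_length :: "('a \<Rightarrow> 'a \<Rightarrow> real) \<Rightarrow> 'a ugraph \<Rightarrow> real" where
  "metric_length d T = (\<Sum>e \<in> edges T. THE r. \<exists>u v. e = {u, v} \<and> r = d u v)"

definition metric_steiner_tree :: "'a set \<Rightarrow> 'a set \<Rightarrow> 'a ugraph \<Rightarrow> bool" where
  "metric_steiner_tree M A T \<longleftrightarrow> is_tree T \<and> A \<subseteq> verts T \<and> verts T \<subseteq> M"

definition metric_steiner_optimal ::
    "'a set \<Rightarrow> ('a \<Rightarrow> 'a \<Rightarrow> real) \<Rightarrow> 'a set \<Rightarrow> 'a ugraph \<Rightarrow> bool" where
  "metric_steiner_optimal M d A T \<longleftrightarrow>
     metric_steiner_tree M A T \<and>
     (\<forall>T'. metric_steiner_tree M A T' \<longrightarrow> metric_length d T \<le> metric_length d T')"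

text \<open>
  The minimum length \<open>\<ell>(A)\<close>, meaningful when an optimal tree for \<open>A\<close> exists. The value at the
  empty set is a convention; it matters only if \<open>M\<close> is empty, when there is no tree in \<open>M\<close>.
\<close>

definition steiner_length :: "'a set \<Rightarrow> ('a \<Rightarrow> 'a \<Rightarrow> real) \<Rightarrow> 'a set \<Rightarrow> real" where
  "steiner_length M d A =
     (if A = {} then 0
      else LEAST r. \<exists>T. metric_steiner_tree M A T \<and> r = metric_length d T)"

text \<open>The truncation \<open>\<delta>\<^sup>(\<^sup>k\<^sup>)\<close> of a set function; the maximum is over a finite set for finite \<open>A\<close>.\<close>

definition truncation :: "nat \<Rightarrow> ('a set \<Rightarrow> real) \<Rightarrow> 'a set \<Rightarrow> real" where
  "truncation k l A = Max {l B |B. card B \<le> k \<and> B \<subseteq> A}"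

section \<open>The diversity Steiner problem\<close>

text \<open>
  The weight \<open>\<delta>\<^sub>w(A)\<close> of the smallest subtree of \<open>T\<close> connecting \<open>A \<subseteq> verts T\<close>. In a tree that subtree
  is unique for nonempty \<open>A\<close>; for empty \<open>A\<close> it is any single vertex, of weight 0.
\<close>

definition subtree_weight :: "'v ugraph \<Rightarrow> ('v set \<Rightarrow> real) \<Rightarrow> 'v set \<Rightarrow> real" where
  "subtree_weight T w A =
     sum w (edges (ARG_MIN (\<lambda>S. card (verts S)) S. is_subtree S T \<and> A \<subseteq> verts S))"

text \<open>
  The vertices of a solution outside \<open>X\<close> are arbitrary objects, so the type of vertices must
  supply infinitely many elements besides those of \<open>X\<close>, even if the type of \<open>X\<close> is finite. In
  \<open>'a + nat\<close> with \<open>X\<close> embedded by \<^const>\<open>Inl\<close>, every finite tree containing \<open>X\<close> has an isomorphic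
  copy fixing \<open>X\<close>. The problem is posed for an arbitrary set function \<open>\<delta>\<close>; for it to be the
  diversity Steiner problem, \<open>(X, \<delta>)\<close> should be a finite diversity.
\<close>

definition diversity_steiner_feasible ::
    "'a set \<Rightarrow> ('a set \<Rightarrow> real) \<Rightarrow> ('a + nat) ugraph \<Rightarrow> (('a + nat) set \<Rightarrow> real) \<Rightarrow> bool" where
  "diversity_steiner_feasible X \<delta> T w \<longleftrightarrow>
     is_tree T \<and> (\<forall>e \<in> edges T. 0 \<le> w e) \<and> Inl ` X \<subseteq> verts T \<and>
     (\<forall>Y \<subseteq> X. subtree_weight T w (Inl ` Y) \<ge> \<delta> Y)"

definition diversity_steiner_optimal ::
    "'a set \<Rightarrow> ('a set \<Rightarrow> real) \<Rightarrow> ('a + nat) ugraph \<Rightarrow> (('a + nat) set \<Rightarrow> real) \<Rightarrow> bool" where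
  "diversity_steiner_optimal X \<delta> T w \<longleftrightarrow>
     diversity_steiner_feasible X \<delta> T w \<and>
     (\<forall>T' w'. diversity_steiner_feasible X \<delta> T' w' \<longrightarrow>
        (\<Sum>e \<in> edges T. w e) \<le> (\<Sum>e \<in> edges T'. w' e))"

end

theory Submission
  imports Defs
begin

text \<open>
  A minimum diversity Steiner tree cannot be longer than any feasible one, so for nonempty
  \<open>X\<close> it is enough that an optimal metric Steiner tree \<open>S\<close> for \<open>X\<close>, with every edge weighted by the distance of its ends,
  is feasible for the diversity Steiner problem of \<open>\<delta>\<^sup>(\<^sup>k\<^sup>)\<close>; its total weight is then \<open>\<ell>(X)\<close>.

  Feasibility holds because a subtree of \<open>S\<close> that connects \<open>Y\<close> is itself a metric Steiner tree
  for every \<open>B \<subseteq> Y\<close>. Its length is therefore at least \<open>\<ell>(B)\<close> for all these \<open>B\<close>, hence at least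
  \<open>\<delta>\<^sup>(\<^sup>k\<^sup>)(Y)\<close> (\<open>feasible_image_of_metric_steiner_tree\<close>).

  The trees of the two problems have vertices of different types, so \<open>S\<close> is carried along the
  injection \<open>Inl\<close>, and subtrees of the image are carried back. This is harmless, since an
  injective renaming of the vertices preserves and reflects being a tree
  (\<open>is_tree_map_graph_iff\<close>).
\<close>

section \<open>Renaming the vertices of a graph\<close>

definition map_graph :: "('v \<Rightarrow> 'u) \<Rightarrow> 'v ugraph \<Rightarrow> 'u ugraph" where
  "map_graph f G = (f ` verts G, (`) f ` edges G)"

lemma verts_map_graph [simp]: "verts (map_graph f G) = f ` verts G"
  and edges_map_graph [simp]: "edges (map_graph f G) = (`) f ` edges G"
  by (simp_all add: map_graph_def)

lemma edge_map_graph_iff: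
  assumes "inj f"
  shows "{f x, f y} \<in> edges (map_graph f G) \<longleftrightarrow> {x, y} \<in> edges G"
  using inj_image_mem_iff [of "(`) f" "{x, y}" "edges G"] assms
  by (simp add: inj_on_image inj_on_subset [OF assms])

lemma edge_map_graph_range:
  assumes "{a, b} \<in> edges (map_graph f G)"
  shows "a \<in> range f" "b \<in> range f"
  using assms by auto

lemma reachable_map_graph_iff:
  assumes "inj f"
  shows "(f x, f y) \<in> {(a, b). {a, b} \<in> edges (map_graph f G)}\<^sup>* \<longleftrightarrow>
         (x, y) \<in> {(a, b). {a, b} \<in> edges G}\<^sup>*"
    (is "_ \<in> ?R'\<^sup>* \<longleftrightarrow> _ \<in> ?R\<^sup>*")
proof
  have "\<exists>y'. b = f y' \<and> (x, y') \<in> ?R\<^sup>*" if "(f x, b) \<in> ?R'\<^sup>*" for b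
    using that
  proof (induction rule: rtrancl_induct)
    case base
    then show ?case by blast
  next
    case (step b c)
    then obtain y' z' where yz: "b = f y'" "(x, y') \<in> ?R\<^sup>*" "c = f z'"
      using edge_map_graph_range(2) [of b c f G] by blast
    then have "(y', z') \<in> ?R"
      using step.hyps edge_map_graph_iff [OF assms, of y' z' G] by simp
    from rtrancl.rtrancl_into_rtrancl [OF yz(2) this] show ?case
      using yz(3) by blast
  qed
  then show "(x, y) \<in> ?R\<^sup>*" if "(f x, f y) \<in> ?R'\<^sup>*"
    using that injD [OF assms] by blast
next
  show "(f x, f y) \<in> ?R'\<^sup>*" if "(x, y) \<in> ?R\<^sup>*"
    using that
  proof (induction rule: rtrancl_induct)
    case (step y z)
    then have "(f y, f z) \<in> ?R'"
      using edge_map_graph_iff [OF assms, of y z G] by simp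
    then show ?case
      using step.IH by (meson rtrancl.rtrancl_into_rtrancl)
  qed simp
qed

lemma is_cycle_map_graph_iff:
  assumes "inj f"
  shows "is_cycle (map_graph f G) (map f p) \<longleftrightarrow> is_cycle G p"
proof (cases "length p \<ge> 3")
  case True
  have "{map f p ! i, map f p ! (Suc i mod length p)} \<in> edges (map_graph f G) \<longleftrightarrow>
        {p ! i, p ! (Suc i mod length p)} \<in> edges G" if "i < length p" for i
  proof -
    have "Suc i mod length p < length p"
      using that by (intro mod_less_divisor) linarith
    then show ?thesis
      using edge_map_graph_iff [OF assms] that by (simp only: nth_map)
  qed
  then show ?thesis
    using assms by (simp add: is_cycle_def distinct_map inj_on_subset [OF assms] del: edges_map_graph)
qed (simp add: is_cycle_def)

text \<open>
  Every vertex of a cycle lies on an edge, so a cycle of the renamed graph stays in the range of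
  the renaming and is itself the renaming of a cycle.
\<close>

lemma ex_cycle_map_graph_iff:
  assumes "inj f"
  shows "(\<exists>p. is_cycle (map_graph f G) p) \<longleftrightarrow> (\<exists>p. is_cycle G p)"
proof
  assume "\<exists>p. is_cycle (map_graph f G) p"
  then obtain p where p: "is_cycle (map_graph f G) p" by blast
  have "p ! i \<in> range f" if "i < length p" for i
    by (rule edge_map_graph_range(1) [of _ "p ! (Suc i mod length p)" f G])
       (use p that in \<open>simp add: is_cycle_def del: edges_map_graph\<close>)
  then have "set p \<subseteq> range f"
    by (auto simp: set_conv_nth)
  then obtain q where "p = map f q"
    using ex_map_conv [of p f] by blast
  then show "\<exists>p. is_cycle G p"
    using p is_cycle_map_graph_iff [OF assms] by blast
next
  show "\<exists>p. is_cycle (map_graph f G) p" if "\<exists>p. is_cycle G p"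
    using that is_cycle_map_graph_iff [OF assms] by blast
qed

lemma is_tree_map_graph_iff:
  assumes "inj f"
  shows "is_tree (map_graph f G) \<longleftrightarrow> is_tree G"
proof -
  have "finite (f ` verts G) \<longleftrightarrow> finite (verts G)"
    using assms by (simp add: finite_image_iff inj_on_subset)
  moreover have "(\<forall>e\<in>edges (map_graph f G). e \<subseteq> f ` verts G \<and> card e = 2) \<longleftrightarrow>
      (\<forall>e\<in>edges G. e \<subseteq> verts G \<and> card e = 2)"
    using assms by (simp add: inj_image_subset_iff card_image inj_on_subset)
  moreover have "(\<forall>u\<in>f ` verts G. \<forall>v\<in>f ` verts G.
        (u, v) \<in> {(x, y). {x, y} \<in> edges (map_graph f G)}\<^sup>*) \<longleftrightarrow>
      (\<forall>u\<in>verts G. \<forall>v\<in>verts G. (u, v) \<in> {(x, y). {x, y} \<in> edges G}\<^sup>*)"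
    using reachable_map_graph_iff [OF assms] by (simp del: edges_map_graph)
  ultimately show ?thesis
    using ex_cycle_map_graph_iff [OF assms, of G]
    unfolding is_tree_def by (simp del: edges_map_graph)
qed

lemma subtree_map_graphE:
  assumes "inj f" and "is_subtree S (map_graph f G)"
  obtains S' where "S = map_graph f S'" "is_subtree S' G"
proof -
  obtain V E where "V \<subseteq> verts G" "verts S = f ` V" "E \<subseteq> edges G" "edges S = (`) f ` E"
    using assms(2) unfolding is_subtree_def by (auto simp: subset_image_iff)
  then have "S = map_graph f (V, E)"
    by (simp add: map_graph_def prod_eq_iff)
  moreover from this have "is_subtree (V, E) G"
    using assms \<open>V \<subseteq> verts G\<close> \<open>E \<subseteq> edges G\<close>
    by (simp add: is_subtree_def is_tree_map_graph_iff)
  ultimately show thesis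
    using that by blast
qed

lemma is_tree_singleton: "is_tree ({v}, {})"
proof -
  have "\<not> is_cycle ({v}, {}) p" for p
    by (cases p) (auto simp: is_cycle_def)
  then show ?thesis
    by (simp add: is_tree_def)
qed

section \<open>Lengths and weights\<close>

lemma edge_length_eq:
  assumes "Metric_space M d"
  shows "(THE r. \<exists>x y. {u, v} = {x, y} \<and> r = d x y) = d u v"
  using Metric_space.commute [OF assms] by (auto simp: doubleton_eq_iff)

lemma edge_length_nonneg:
  assumes "Metric_space M d" and "card e = 2"
  shows "0 \<le> (THE r. \<exists>u v. e = {u, v} \<and> r = d u v)"
proof -
  obtain u v where "e = {u, v}"
    using assms(2) by (auto simp: card_2_iff)
  then show ?thesis
    using Metric_space.nonneg [OF assms(1)] by (simp add: edge_length_eq [OF assms(1)])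
qed

lemma metric_length_nonneg:
  assumes "Metric_space M d" and "is_tree T"
  shows "0 \<le> metric_length d T"
  unfolding metric_length_def
  by (rule sum_nonneg, rule edge_length_nonneg [OF assms(1)])
     (use assms(2) in \<open>auto simp: is_tree_def\<close>)

lemma steiner_length_eq:
  assumes "metric_steiner_optimal M d A S" and "A \<noteq> {}"
  shows "steiner_length M d A = metric_length d S"
proof -
  have "(LEAST r. \<exists>T. metric_steiner_tree M A T \<and> r = metric_length d T) = metric_length d S"
    using assms(1) unfolding metric_steiner_optimal_def by (intro Least_equality) blast+
  then show ?thesis
    using assms(2) by (simp add: steiner_length_def)
qed

lemma steiner_length_le_metric_length:
  assumes "Metric_space M d"
    and "\<And>A. A \<subseteq> X \<Longrightarrow> A \<noteq> {} \<Longrightarrow> \<exists>S. metric_steiner_optimal M d A S"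
    and "A \<subseteq> X" and "metric_steiner_tree M A S"
  shows "steiner_length M d A \<le> metric_length d S"
proof (cases "A = {}")
  case True
  then show ?thesis
    using metric_length_nonneg [OF assms(1)] assms(4)
    by (simp add: steiner_length_def metric_steiner_tree_def)
next
  case False
  then obtain S' where "metric_steiner_optimal M d A S'"
    using assms by blast
  then show ?thesis
    using False assms(4) steiner_length_eq unfolding metric_steiner_optimal_def by metis
qed

lemma truncation_le:
  assumes "finite A" and "\<And>B. B \<subseteq> A \<Longrightarrow> l B \<le> c"
  shows "truncation k l A \<le> c"
proof -
  have "finite {l B |B. card B \<le> k \<and> B \<subseteq> A}"
    by (rule finite_subset [of _ "l ` Pow A"]) (use assms in auto)
  moreover have "l {} \<in> {l B |B. card B \<le> k \<and> B \<subseteq> A}"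
    by force
  ultimately show ?thesis
    using assms(2) unfolding truncation_def by (subst Max_le_iff) auto
qed

text \<open>
  A choice of a smallest connecting subtree is possible because the tree itself connects \<open>A\<close>. A
  lower bound for the weights of all connecting subtrees is thus a lower bound for \<open>\<delta>\<^sub>w(A)\<close>.
\<close>

lemma subtree_weightE:
  assumes "is_tree T" and "A \<subseteq> verts T"
  obtains S where "is_subtree S T" "A \<subseteq> verts S" "subtree_weight T w A = sum w (edges S)"
proof -
  have "is_subtree T T \<and> A \<subseteq> verts T"
    using assms by (simp add: is_subtree_def)
  from arg_min_natI [of "\<lambda>S. is_subtree S T \<and> A \<subseteq> verts S", OF this]
  show thesis
    using that unfolding subtree_weight_def by blast
qed

section \<open>Metric Steiner trees are feasible\<close>

definition image_edge_length :: "('a \<Rightarrow> 'a \<Rightarrow> real) \<Rightarrow> ('a + nat) set \<Rightarrow> real" where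
  "image_edge_length d e = (THE r. \<exists>u v. Inl -` e = {u, v} \<and> r = d u v)"

lemma sum_image_edge_length:
  fixes S :: "'a ugraph"
  shows "sum (image_edge_length d) (edges (map_graph Inl S)) = metric_length d S"
proof -
  have "inj_on ((`) (Inl :: 'a \<Rightarrow> 'a + nat)) (edges S)"
    by (simp add: inj_on_image)
  then show ?thesis
    by (simp add: sum.reindex metric_length_def image_edge_length_def inj_vimage_image_eq)
qed

lemma feasible_image_of_metric_steiner_tree:
  fixes S :: "'a ugraph"
  assumes "Metric_space M d" and "finite X"
    and ex: "\<And>A. A \<subseteq> X \<Longrightarrow> A \<noteq> {} \<Longrightarrow> \<exists>S. metric_steiner_optimal M d A S"
    and S: "metric_steiner_tree M X S"
  shows "diversity_steiner_feasible X (truncation k (steiner_length M d))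
           (map_graph Inl S) (image_edge_length d)"
  unfolding diversity_steiner_feasible_def
proof (intro conjI allI impI ballI)
  show tree: "is_tree (map_graph Inl S)"
    using S by (simp add: metric_steiner_tree_def is_tree_map_graph_iff)
  show verts: "Inl ` X \<subseteq> verts (map_graph Inl S)"
    using S by (auto simp: metric_steiner_tree_def)
  show "0 \<le> image_edge_length d e" if e: "e \<in> edges (map_graph Inl S)" for e
  proof -
    obtain e' where "e = Inl ` e'" "card e' = 2"
      using e S by (auto simp: metric_steiner_tree_def is_tree_def)
    then show ?thesis
      using edge_length_nonneg [OF assms(1)]
      by (simp add: image_edge_length_def inj_vimage_image_eq)
  qed
  fix Y assume "Y \<subseteq> X"
  then have "Inl ` Y \<subseteq> verts (map_graph Inl S)"
    using verts by blast
  then obtain U where U: "is_subtree U (map_graph Inl S)" "Inl ` Y \<subseteq> verts U"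
    "subtree_weight (map_graph Inl S) (image_edge_length d) (Inl ` Y)
       = sum (image_edge_length d) (edges U)"
    by (rule subtree_weightE [OF tree])
  obtain U' where U': "U = map_graph Inl U'" "is_subtree U' S"
    by (rule subtree_map_graphE [OF inj_Inl U(1)])
  then have "metric_steiner_tree M B U'" if "B \<subseteq> Y" for B
    using that U(2) S by (auto simp: metric_steiner_tree_def is_subtree_def)
  then have "truncation k (steiner_length M d) Y \<le> metric_length d U'"
    using \<open>Y \<subseteq> X\<close> \<open>finite X\<close> finite_subset
    by (intro truncation_le steiner_length_le_metric_length [OF assms(1) ex]) auto
  then show "truncation k (steiner_length M d) Y
      \<le> subtree_weight (map_graph Inl S) (image_edge_length d) (Inl ` Y)"
    using U(3) U'(1) sum_image_edge_length by metis
qed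

text \<open>
  For \<open>X = {}\<close> the metric space may be empty and provide no tree at all, while \<open>\<ell>(X) = 0\<close> by
  convention. A single vertex outside the space then takes the place of the metric Steiner tree.
\<close>

lemma feasible_singleton:
  assumes "\<delta> {} \<le> 0"
  shows "diversity_steiner_feasible {} \<delta> ({v}, {}) w"
proof -
  obtain S where "is_subtree S ({v}, {})" "subtree_weight ({v}, {}) w {} = sum w (edges S)"
    by (rule subtree_weightE [OF is_tree_singleton [of v], of "{}" w]) auto
  then have "subtree_weight ({v}, {}) w {} = 0"
    by (simp add: is_subtree_def)
  then show ?thesis
    using assms by (simp add: diversity_steiner_feasible_def is_tree_singleton)
qed

theorem proposition6p2:
  fixes M :: "'a set" and d :: "'a \<Rightarrow> 'a \<Rightarrow> real" and X :: "'a set" and k :: nat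
    and T :: "('a + nat) ugraph" and w :: "('a + nat) set \<Rightarrow> real"
  assumes "Metric_space M d"
    and "X \<subseteq> M" and "finite X"
    and "k \<ge> 2"
    and "\<And>A. A \<subseteq> X \<Longrightarrow> A \<noteq> {} \<Longrightarrow> \<exists>S. metric_steiner_optimal M d A S"
    and "diversity_steiner_optimal X (truncation k (steiner_length M d)) T w"
  shows "(\<Sum>e \<in> edges T. w e) \<le> steiner_length M d X"
proof (cases "X = {}")
  case True
  have "truncation k (steiner_length M d) {} \<le> 0"
    by (rule truncation_le) (auto simp: steiner_length_def)
  then have "diversity_steiner_feasible X (truncation k (steiner_length M d)) ({Inr 0}, {}) w"
    using True feasible_singleton by blast
  then have "(\<Sum>e \<in> edges T. w e) \<le> (\<Sum>e \<in> edges ({Inr 0}, {}). w e)"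
    using assms(6) unfolding diversity_steiner_optimal_def by blast
  then show ?thesis
    using True by (simp add: steiner_length_def)
next
  case False
  then obtain S where S: "metric_steiner_optimal M d X S"
    using assms(5) by blast
  then have "metric_steiner_tree M X S"
    by (simp add: metric_steiner_optimal_def)
  from feasible_image_of_metric_steiner_tree [OF assms(1,3,5) this, where k = k]
  have "(\<Sum>e \<in> edges T. w e) \<le> sum (image_edge_length d) (edges (map_graph Inl S))"
    using assms(6) unfolding diversity_steiner_optimal_def by blast
  also have "\<dots> = steiner_length M d X"
    using S False by (simp add: sum_image_edge_length steiner_length_eq del: edges_map_graph)
  finally show ?thesis .
qed

end
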